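(* Let $(X,R,S,\{e\})$ be a finitely decomposable relational interchange monoid with single unit $e$ such that both relational monoids $(X,R,\{e\})$ and $(X,S,\{e\})$ are graded, and let $(K,+,\bullet,\diamond,0,1,{}^{\star_\bullet},{}^{\star_\diamond})$ be an interchange Kleene algebra. Then $K^X$, with pointwise addition, constant $0$, unit $\delta_e$ ($\delta_e(e)=1$, $\delta_e(x)=0$ for $x\ne e$), convolutions $(f\ast g)(x)=\sum\{f(y)\bullet g(z)\mid R^x_{yz}\}$ and $(f\circledast g)(x)=\sum\{f(y)\diamond g(z)\mid S^x_{yz}\}$, and stars $f^{\star_\ast}(e)=(f(e))^{\star_\bullet}$, $f^{\star_\ast}(x)=(f(e))^{\star_\bullet}\bullet\sum\{f(y)\bullet f^{\star_\ast}(z)\mid R^x_{yz},y\ne e\}$ for $x\ne e$, and analogously $f^{\star_\circledast}$ using $S$, $\diamond$ and ${}^{\star_\diamond}$, is an interchange Kleene algebra.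
   Context: $R^x_{yz}$ denotes that ternary relation $R$ holds at $(x,y,z)$. Relational associativity of $R$: for all $x,u,v,w$, $(\exists y.\ R^y_{uv}\wedge R^x_{yw})\Leftrightarrow(\exists y.\ R^x_{uy}\wedge R^y_{vw})$. $\{e\}$ is a set of relational units for $R$ if for all $x,y$: $R^x_{ex}$, $R^x_{xe}$, and $R^x_{ey}\Rightarrow x=y$, $R^x_{ye}\Rightarrow x=y$. A relational interchange monoid $(X,R,S,\{e\})$: $R,S$ relationally associative with relational unit set $\{e\}$, satisfying for all $t,u,v,w,x$: $(\exists y,z.\ S^y_{tu}\wedge R^x_{yz}\wedge S^z_{vw})\Rightarrow(\exists y,z.\ R^y_{tv}\wedge S^x_{yz}\wedge R^z_{uw})$. Finitely decomposable: for each $x$ the sets $\{(y,z)\mid R^x_{yz}\}$ and $\{(y,z)\mid S^x_{yz}\}$ are finite. A grading of $(X,R,\{e\})$ is $|\cdot|:X\to\mathbb{N}$ with $|x|>0$ for $x\ne e$ and $|x|=|y|+|z|$ whenever $R^x_{yz}$. A Kleene algebra is a dioid (semiring with idempotent $+$, ordered by $a\le b\iff a+b=b$) with $^\star$ satisfying $1+a\bullet a^\star\le a^\star$, $c+a\bullet b\le b\Rightarrow a^\star\bullet c\le b$, $1+a^\star\bullet a\le a^\star$, $c+b\bullet a\le b\Rightarrow c\bullet a^\star\le b$. An interchange Kleene algebra is $(K,+,\bullet,\diamond,0,1,{}^{\star_\bullet},{}^{\star_\diamond})$ such that $(K,+,\bullet,0,1,{}^{\star_\bullet})$ and $(K,+,\diamond,0,1,{}^{\star_\diamond})$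 are Kleene algebras and $(a\diamond b)\bullet(c\diamond d)\le(a\bullet c)\diamond(b\bullet d)$ for all $a,b,c,d$. *)

theory Defs
  imports Main
begin

text \<open>A ternary relation is a curried predicate; \<open>R x y z\<close> stands for $R^x_{yz}$.\<close>

type_synonym 'x ternary = "'x \<Rightarrow> 'x \<Rightarrow> 'x \<Rightarrow> bool"

locale relational_monoid =
  fixes R :: "'x ternary" and e :: 'x
  assumes rel_assoc: "(\<exists>y. R y u v \<and> R x y w) \<longleftrightarrow> (\<exists>y. R x u y \<and> R y v w)"
    and rel_unit_left: "R x e x"
    and rel_unit_right: "R x x e"
    and rel_unit_left_eq: "R x e y \<Longrightarrow> x = y"
    and rel_unit_right_eq: "R x y e \<Longrightarrow> x = y"

locale relational_interchange_monoid =
  R: relational_monoid R e + S: relational_monoid S e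
  for R S :: "'x ternary" and e :: 'x +
  assumes rel_interchange:
    "(\<exists>y z. S y t u \<and> R x y z \<and> S z v w) \<Longrightarrow> (\<exists>y z. R y t v \<and> S x y z \<and> R z u w)"

definition finitely_decomposable :: "'x ternary \<Rightarrow> bool" where
  "finitely_decomposable R \<longleftrightarrow> (\<forall>x. finite {(y, z). R x y z})"

definition grading :: "'x ternary \<Rightarrow> 'x \<Rightarrow> ('x \<Rightarrow> nat) \<Rightarrow> bool" where
  "grading R e g \<longleftrightarrow> (\<forall>x. x \<noteq> e \<longrightarrow> 0 < g x) \<and> (\<forall>x y z. R x y z \<longrightarrow> g x = g y + g z)"

definition graded :: "'x ternary \<Rightarrow> 'x \<Rightarrow> bool" where
  "graded R e \<longleftrightarrow> (\<exists>g. grading R e g)"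

text \<open>The algebras take their operations as explicit parameters, because one type carries two
  multiplications and because the convolution algebra on functions has to be an instance.
  The case \<open>zero = one\<close> is not excluded.\<close>

locale dioid =
  add: comm_monoid add zero + mult: monoid mult one
  for add :: "'k \<Rightarrow> 'k \<Rightarrow> 'k" (infixl "\<oplus>" 65)
    and mult :: "'k \<Rightarrow> 'k \<Rightarrow> 'k" (infixl "\<odot>" 70)
    and zero :: 'k and one :: 'k +
  assumes distrib_left: "a \<odot> (b \<oplus> c) = a \<odot> b \<oplus> a \<odot> c"
    and distrib_right: "(a \<oplus> b) \<odot> c = a \<odot> c \<oplus> b \<odot> c"
    and zero_left: "zero \<odot> a = zero"
    and zero_right: "a \<odot> zero = zero"
    and add_idem: "a \<oplus> a = a"
begin

definition le :: "'k \<Rightarrow> 'k \<Rightarrow> bool" (infix "\<sqsubseteq>" 50) where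
  "a \<sqsubseteq> b \<longleftrightarrow> a \<oplus> b = b"

end

locale kleene_algebra = dioid +
  fixes star :: "'a \<Rightarrow> 'a"
  assumes star_unfold_left: "one \<oplus> a \<odot> star a \<sqsubseteq> star a"
    and star_induct_left: "c \<oplus> a \<odot> b \<sqsubseteq> b \<Longrightarrow> star a \<odot> c \<sqsubseteq> b"
    and star_unfold_right: "one \<oplus> star a \<odot> a \<sqsubseteq> star a"
    and star_induct_right: "c \<oplus> b \<odot> a \<sqsubseteq> b \<Longrightarrow> c \<odot> star a \<sqsubseteq> b"

locale interchange_kleene_algebra =
  seq: kleene_algebra add seq zero one star_seq +
  par: kleene_algebra add par zero one star_par
  for add :: "'k \<Rightarrow> 'k \<Rightarrow> 'k"
    and seq :: "'k \<Rightarrow> 'k \<Rightarrow> 'k" (infixl "\<bullet>" 70)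
    and par :: "'k \<Rightarrow> 'k \<Rightarrow> 'k" (infixl "\<diamondop>" 70)
    and zero one :: 'k
    and star_seq star_par :: "'k \<Rightarrow> 'k" +
  assumes interchange: "seq.le ((a \<diamondop> b) \<bullet> (c \<diamondop> d)) ((a \<bullet> c) \<diamondop> (b \<bullet> d))"

definition delta :: "'k \<Rightarrow> 'k \<Rightarrow> 'x \<Rightarrow> 'x \<Rightarrow> 'k" where
  "delta zero one e x = (if x = e then one else zero)"

text \<open>Sums are indexed by the decompositions \<open>(y, z)\<close> of \<open>x\<close>. As addition is idempotent, for finitely
  many decompositions this agrees with summing the set of values.\<close>

definition conv ::
  "('k \<Rightarrow> 'k \<Rightarrow> 'k) \<Rightarrow> 'k \<Rightarrow> ('k \<Rightarrow> 'k \<Rightarrow> 'k) \<Rightarrow> 'x ternary \<Rightarrow> ('x \<Rightarrow> 'k) \<Rightarrow> ('x \<Rightarrow> 'k) \<Rightarrow> 'x \<Rightarrow> 'k"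
  where
  "conv add zero mult R f g x =
     comm_monoid_set.F add zero (\<lambda>(y, z). mult (f y) (g z)) {(y, z). R x y z}"

text \<open>The defining equations of the star are recursive. The recursive calls for \<open>x\<close> are made at
  those \<open>z\<close> with $R^x_{yz}$ for some \<open>y \<noteq> e\<close>; a grading makes this relation well-founded, and the
  equations are then recovered in \<open>conv_star_unit\<close> and \<open>conv_star_nonunit\<close> below.\<close>

definition conv_star ::
  "('k \<Rightarrow> 'k \<Rightarrow> 'k) \<Rightarrow> 'k \<Rightarrow> ('k \<Rightarrow> 'k \<Rightarrow> 'k) \<Rightarrow> ('k \<Rightarrow> 'k) \<Rightarrow> 'x ternary \<Rightarrow> 'x \<Rightarrow>
    ('x \<Rightarrow> 'k) \<Rightarrow> 'x \<Rightarrow> 'k"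
  where
  "conv_star add zero mult star R e f =
     wfrec {(z, x). \<exists>y. y \<noteq> e \<and> R x y z}
       (\<lambda>h x. if x = e then star (f e)
              else mult (star (f e))
                     (comm_monoid_set.F add zero (\<lambda>(y, z). mult (f y) (h z))
                        {(y, z). R x y z \<and> y \<noteq> e}))"

lemma wf_decomposition:
  assumes "graded R e"
  shows "wf {(z, x). \<exists>y. y \<noteq> e \<and> R x y z}"
proof -
  obtain g where g: "grading R e g"
    using assms by (auto simp: graded_def)
  have "{(z, x). \<exists>y. y \<noteq> e \<and> R x y z} \<subseteq> measure g"
    using g by (fastforce simp: grading_def)
  then show ?thesis
    by (rule wf_subset[OF wf_measure])
qed

lemma conv_star_unit:
  assumes "graded R e"
  shows "conv_star add zero mult star R e f e = star (f e)"
  unfolding conv_star_def by (subst wfrec[OF wf_decomposition[OF assms]]) simp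

lemma conv_star_nonunit:
  assumes "graded R e" and "comm_monoid add zero" and "x \<noteq> e"
  shows "conv_star add zero mult star R e f x =
    mult (star (f e))
      (comm_monoid_set.F add zero (\<lambda>(y, z). mult (f y) (conv_star add zero mult star R e f z))
        {(y, z). R x y z \<and> y \<noteq> e})"
proof -
  interpret comm_monoid_set add zero
    using assms(2) by (simp add: comm_monoid_set_def)
  show ?thesis
    unfolding conv_star_def
    by (subst wfrec[OF wf_decomposition[OF assms(1)]])
       (use assms(3) in \<open>auto simp: cut_def intro!: arg_cong[where f = "mult (star (f e))"] cong\<close>)
qed

end

theory Submission
  imports Defs
begin

text \<open>
  A finite sum in a dioid is the least upper bound of its summands, so every inequality between
  convolutions reduces to inequalities between the summands indexed by single decompositions, and
  associativity and interchange transfer directly from the relations to the convolutions.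

  For the star, split \<open>f\<close> into its value \<open>a = f e\<close> at the unit and the remainder \<open>f' = f(e := 0)\<close>. As
  \<open>e\<close> decomposes only trivially, the two defining equations combine to \<open>f\<^sup>\<star> = a\<^sup>\<star> (\<delta> + f' * f\<^sup>\<star>)\<close>. If
  \<open>f * b \<le> b\<close>, then \<open>f\<^sup>\<star>(y) b(z) \<le> b(x)\<close> whenever $R^x_{yz}$, by well-founded induction on \<open>y\<close>: a
  summand \<open>f'(u) f\<^sup>\<star>(v) b(z)\<close> is reassociated along $R^x_{uw}$, $R^w_{vz}$, and star induction for
  \<open>a\<close> absorbs the factor \<open>a\<^sup>\<star>\<close>. The case \<open>b * f \<le> b\<close> is dual, and these two properties together
  with the left unfold law imply the remaining axioms.
\<close>

context dioid
begin

sublocale sum: comm_monoid_set add zero ..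

sublocale order: bounded_semilattice_sup_bot "(\<oplus>)" "(\<sqsubseteq>)" "\<lambda>a b. a \<sqsubseteq> b \<and> \<not> b \<sqsubseteq> a" zero
proof
  fix a b c
  show "a \<sqsubseteq> c" if "a \<sqsubseteq> b" and "b \<sqsubseteq> c"
    using that unfolding le_def by (metis add.assoc)
  show "a = b" if "a \<sqsubseteq> b" and "b \<sqsubseteq> a"
    using that unfolding le_def by (metis add.commute)
  show "b \<oplus> c \<sqsubseteq> a" if "b \<sqsubseteq> a" and "c \<sqsubseteq> a"
    using that unfolding le_def by (metis add.assoc)
  show "a \<sqsubseteq> a \<oplus> b"
    unfolding le_def by (metis add.assoc add_idem)
  show "b \<sqsubseteq> a \<oplus> b"
    unfolding le_def by (metis add.left_commute add_idem)
qed (simp_all add: le_def add_idem)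

declare order.order_trans [trans]

lemma fun_eq_if_same_upper_bounds:
  assumes "\<And>x c. f x \<sqsubseteq> c \<longleftrightarrow> g x \<sqsubseteq> c"
  shows "f = g"
proof
  show "f x = g x" for x
    using assms order.order_refl by (intro order.order_antisym) blast+
qed

lemma mult_left_mono:
  assumes "a \<sqsubseteq> b"
  shows "c \<odot> a \<sqsubseteq> c \<odot> b"
  using assms unfolding le_def by (metis distrib_left)

lemma mult_right_mono:
  assumes "a \<sqsubseteq> b"
  shows "a \<odot> c \<sqsubseteq> b \<odot> c"
  using assms unfolding le_def by (metis distrib_right)

lemma mult_mono:
  assumes "a \<sqsubseteq> b" and "c \<sqsubseteq> d"
  shows "a \<odot> c \<sqsubseteq> b \<odot> d"
  using mult_right_mono[OF assms(1)] mult_left_mono[OF assms(2)] by (rule order.order_trans)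

lemma sum_le_iff: "finite A \<Longrightarrow> sum.F h A \<sqsubseteq> c \<longleftrightarrow> (\<forall>i\<in>A. h i \<sqsubseteq> c)"
  by (induction A rule: finite_induct) auto

lemma mult_sum_le_iff: "finite A \<Longrightarrow> a \<odot> sum.F h A \<sqsubseteq> c \<longleftrightarrow> (\<forall>i\<in>A. a \<odot> h i \<sqsubseteq> c)"
  by (induction A rule: finite_induct) (auto simp: zero_right distrib_left)

lemma sum_mult_le_iff: "finite A \<Longrightarrow> sum.F h A \<odot> a \<sqsubseteq> c \<longleftrightarrow> (\<forall>i\<in>A. h i \<odot> a \<sqsubseteq> c)"
  by (induction A rule: finite_induct) (auto simp: zero_left distrib_right)

lemma kleene_algebraI:
  assumes one_le_star: "\<And>a. one \<sqsubseteq> star a"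
    and mult_star_le_star: "\<And>a. a \<odot> star a \<sqsubseteq> star a"
    and star_mult_le: "\<And>a b. a \<odot> b \<sqsubseteq> b \<Longrightarrow> star a \<odot> b \<sqsubseteq> b"
    and mult_star_le: "\<And>a b. b \<odot> a \<sqsubseteq> b \<Longrightarrow> b \<odot> star a \<sqsubseteq> b"
  shows "kleene_algebra add mult zero one star"
proof
  fix a b c
  show "one \<oplus> a \<odot> star a \<sqsubseteq> star a"
    by (simp add: one_le_star mult_star_le_star)
  have "a \<sqsubseteq> a \<odot> star a"
    using mult_left_mono[OF one_le_star, of a a] by simp
  also note mult_star_le_star
  finally have "star a \<odot> a \<sqsubseteq> star a \<odot> star a"
    by (rule mult_left_mono)
  also have "\<dots> \<sqsubseteq> star a"
    by (intro star_mult_le mult_star_le_star)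
  finally show "one \<oplus> star a \<odot> a \<sqsubseteq> star a"
    by (simp add: one_le_star)
  show "star a \<odot> c \<sqsubseteq> b" if "c \<oplus> a \<odot> b \<sqsubseteq> b"
    using that order.order_trans[OF mult_left_mono star_mult_le] by simp
  show "c \<odot> star a \<sqsubseteq> b" if "c \<oplus> b \<odot> a \<sqsubseteq> b"
    using that order.order_trans[OF mult_right_mono mult_star_le] by simp
qed

end

context kleene_algebra
begin

lemma one_le_star: "one \<sqsubseteq> star a"
  using star_unfold_left[of a] by simp

lemma mult_star_le_star: "a \<odot> star a \<sqsubseteq> star a"
  using star_unfold_left[of a] by simp

lemma star_mult_le: "a \<odot> b \<sqsubseteq> b \<Longrightarrow> star a \<odot> b \<sqsubseteq> b"
  by (rule star_induct_left) simp

lemma mult_star_le: "b \<odot> a \<sqsubseteq> b \<Longrightarrow> b \<odot> star a \<sqsubseteq> b"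
  by (rule star_induct_right) simp

end

locale relational_convolution =
  dioid add mult zero one
  for add :: "'k \<Rightarrow> 'k \<Rightarrow> 'k" (infixl "\<oplus>" 65)
    and mult :: "'k \<Rightarrow> 'k \<Rightarrow> 'k" (infixl "\<odot>" 70)
    and zero one :: 'k +
  fixes R :: "'x ternary"
  assumes finitely_decomposable: "finitely_decomposable R"
begin

abbreviation convolution :: "('x \<Rightarrow> 'k) \<Rightarrow> ('x \<Rightarrow> 'k) \<Rightarrow> 'x \<Rightarrow> 'k" (infixl "\<otimes>" 70) where
  "f \<otimes> g \<equiv> conv add zero mult R f g"

lemma finite_decompositions [simp]: "finite {(y, z). R x y z}"
  using finitely_decomposable by (simp add: finitely_decomposable_def)

lemma conv_le_iff: "(f \<otimes> g) x \<sqsubseteq> c \<longleftrightarrow> (\<forall>y z. R x y z \<longrightarrow> f y \<odot> g z \<sqsubseteq> c)"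
  by (auto simp: conv_def sum_le_iff)

lemma mult_conv_le_iff: "a \<odot> (f \<otimes> g) x \<sqsubseteq> c \<longleftrightarrow> (\<forall>y z. R x y z \<longrightarrow> a \<odot> (f y \<odot> g z) \<sqsubseteq> c)"
  by (auto simp: conv_def mult_sum_le_iff)

lemma conv_mult_le_iff: "(f \<otimes> g) x \<odot> a \<sqsubseteq> c \<longleftrightarrow> (\<forall>y z. R x y z \<longrightarrow> f y \<odot> g z \<odot> a \<sqsubseteq> c)"
  by (auto simp: conv_def sum_mult_le_iff)

lemma mult_le_conv: "R x y z \<Longrightarrow> f y \<odot> g z \<sqsubseteq> (f \<otimes> g) x"
  using conv_le_iff order.order_refl by blast

end

locale convolution_interchange =
  seq: relational_convolution add seq zero one_seq R +
  par: relational_convolution add par zero one_par S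
  for add :: "'k \<Rightarrow> 'k \<Rightarrow> 'k"
    and seq :: "'k \<Rightarrow> 'k \<Rightarrow> 'k" (infixl "\<bullet>" 70)
    and par :: "'k \<Rightarrow> 'k \<Rightarrow> 'k" (infixl "\<diamondop>" 70)
    and zero one_seq one_par :: 'k
    and R S :: "'x ternary" +
  assumes interchange: "seq.le ((a \<diamondop> b) \<bullet> (c \<diamondop> d)) ((a \<bullet> c) \<diamondop> (b \<bullet> d))"
    and rel_interchange:
      "(\<exists>y z. S y t u \<and> R x y z \<and> S z v w) \<Longrightarrow> (\<exists>y z. R y t v \<and> S x y z \<and> R z u w)"
begin

\<comment> \<open>Both copies of \<open>le\<close> are \<open>dioid.le add\<close>, so keeping the two inherited infixes would be ambiguous.\<close>
no_notation par.le (infix "\<sqsubseteq>" 50)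
notation seq.convolution (infixl "\<otimes>\<^sub>R" 70)
notation par.convolution (infixl "\<otimes>\<^sub>S" 70)

lemma summand_interchange:
  assumes "S y t u" and "R x y z" and "S z v w"
  shows "(f t \<diamondop> g u) \<bullet> (h v \<diamondop> k w) \<sqsubseteq> ((f \<otimes>\<^sub>R h) \<otimes>\<^sub>S (g \<otimes>\<^sub>R k)) x"
proof -
  obtain y' z' where "R y' t v" and "S x y' z'" and "R z' u w"
    using assms rel_interchange by metis
  note interchange
  also have "(f t \<bullet> h v) \<diamondop> (g u \<bullet> k w) \<sqsubseteq> (f \<otimes>\<^sub>R h) y' \<diamondop> (g \<otimes>\<^sub>R k) z'"
    using \<open>R y' t v\<close> \<open>R z' u w\<close> by (intro par.mult_mono seq.mult_le_conv)
  also have "\<dots> \<sqsubseteq> ((f \<otimes>\<^sub>R h) \<otimes>\<^sub>S (g \<otimes>\<^sub>R k)) x"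
    using \<open>S x y' z'\<close> by (rule par.mult_le_conv)
  finally show ?thesis .
qed

lemma conv_interchange:
  "((f \<otimes>\<^sub>S g) \<otimes>\<^sub>R (h \<otimes>\<^sub>S k)) x \<sqsubseteq> ((f \<otimes>\<^sub>R h) \<otimes>\<^sub>S (g \<otimes>\<^sub>R k)) x"
proof -
  have "(f \<otimes>\<^sub>S g) y \<bullet> (h \<otimes>\<^sub>S k) z \<sqsubseteq> ((f \<otimes>\<^sub>R h) \<otimes>\<^sub>S (g \<otimes>\<^sub>R k)) x" if "R x y z" for y z
    unfolding conv_def[of add zero par S f g] conv_def[of add zero par S h k]
    using that
    by (auto simp: seq.sum_mult_le_iff seq.mult_sum_le_iff intro: summand_interchange)
  then show ?thesis
    by (simp add: seq.conv_le_iff)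
qed

end

locale convolution_dioid =
  relational_convolution add mult zero one R + relational_monoid R e
  for add :: "'k \<Rightarrow> 'k \<Rightarrow> 'k" (infixl "\<oplus>" 65)
    and mult :: "'k \<Rightarrow> 'k \<Rightarrow> 'k" (infixl "\<odot>" 70)
    and zero one :: 'k
    and R :: "'x ternary" and e :: 'x
begin

abbreviation conv_unit :: "'x \<Rightarrow> 'k" ("\<delta>") where
  "\<delta> \<equiv> delta zero one e"

lemma conv_assoc: "f \<otimes> g \<otimes> h = f \<otimes> (g \<otimes> h)"
proof (rule fun_eq_if_same_upper_bounds)
  fix x c
  have "(f \<otimes> g \<otimes> h) x \<sqsubseteq> c \<longleftrightarrow>
      (\<forall>u v w. (\<exists>y. R y u v \<and> R x y w) \<longrightarrow> f u \<odot> g v \<odot> h w \<sqsubseteq> c)"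
    by (auto simp: conv_le_iff conv_mult_le_iff)
  also have "\<dots> \<longleftrightarrow> (f \<otimes> (g \<otimes> h)) x \<sqsubseteq> c"
    unfolding rel_assoc by (auto simp: conv_le_iff mult_conv_le_iff mult.assoc)
  finally show "(f \<otimes> g \<otimes> h) x \<sqsubseteq> c \<longleftrightarrow> (f \<otimes> (g \<otimes> h)) x \<sqsubseteq> c" .
qed

lemma delta_conv: "\<delta> \<otimes> f = f"
proof (rule fun_eq_if_same_upper_bounds)
  show "(\<delta> \<otimes> f) x \<sqsubseteq> c \<longleftrightarrow> f x \<sqsubseteq> c" for x c
    using rel_unit_left[of x] by (auto simp: conv_le_iff delta_def zero_left dest: rel_unit_left_eq)
qed

lemma conv_delta: "f \<otimes> \<delta> = f"
proof (rule fun_eq_if_same_upper_bounds)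
  show "(f \<otimes> \<delta>) x \<sqsubseteq> c \<longleftrightarrow> f x \<sqsubseteq> c" for x c
    using rel_unit_right[of x] by (auto simp: conv_le_iff delta_def zero_right dest: rel_unit_right_eq)
qed

sublocale conv: dioid "\<lambda>f g x. f x \<oplus> g x" "conv add zero mult R" "\<lambda>x. zero" \<delta>
proof
  fix f g h :: "'x \<Rightarrow> 'k"
  show "f \<otimes> (\<lambda>x. g x \<oplus> h x) = (\<lambda>x. (f \<otimes> g) x \<oplus> (f \<otimes> h) x)"
    by (rule fun_eq_if_same_upper_bounds) (auto simp: conv_le_iff distrib_left)
  show "(\<lambda>x. f x \<oplus> g x) \<otimes> h = (\<lambda>x. (f \<otimes> h) x \<oplus> (g \<otimes> h) x)"
    by (rule fun_eq_if_same_upper_bounds) (auto simp: conv_le_iff distrib_right)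
  show "(\<lambda>x. zero) \<otimes> f = (\<lambda>x. zero)"
    by (rule fun_eq_if_same_upper_bounds) (simp add: conv_le_iff zero_left)
  show "f \<otimes> (\<lambda>x. zero) = (\<lambda>x. zero)"
    by (rule fun_eq_if_same_upper_bounds) (simp add: conv_le_iff zero_right)
qed (simp_all add: conv_assoc delta_conv conv_delta add_idem ac_simps)

lemma fun_le_iff: "conv.le f g \<longleftrightarrow> (\<forall>x. f x \<sqsubseteq> g x)"
  by (auto simp: conv.le_def le_def fun_eq_iff)

lemma conv_fun_le_iff: "conv.le (f \<otimes> g) h \<longleftrightarrow> (\<forall>x y z. R x y z \<longrightarrow> f y \<odot> g z \<sqsubseteq> h x)"
  by (simp add: fun_le_iff conv_le_iff)

end

locale graded_relational_monoid = relational_monoid +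
  assumes graded: "graded R e"
begin

lemma unit_decomposition:
  assumes "R e y z"
  shows "y = e \<and> z = e"
proof -
  obtain g :: "_ \<Rightarrow> nat" where pos: "\<And>x. x \<noteq> e \<Longrightarrow> 0 < g x"
    and additive: "\<And>x y z. R x y z \<Longrightarrow> g x = g y + g z"
    using graded unfolding graded_def grading_def by blast
  have "g e = 0"
    using additive[OF rel_unit_left[of e]] by simp
  then have "g y = 0" and "g z = 0"
    using additive[OF assms] by simp_all
  then show ?thesis
    using pos[of y] pos[of z] by auto
qed

lemma decomposition_induct [case_names less]:
  assumes "\<And>x. (\<And>y z. R x y z \<Longrightarrow> y \<noteq> e \<Longrightarrow> P z) \<Longrightarrow> P x"
  shows "P x"
  using wf_decomposition[OF graded] by (induction x rule: wf_induct_rule) (auto intro: assms)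

end

locale convolution_kleene_algebra =
  kleene_algebra add mult zero one star + convolution_dioid add mult zero one R e +
  graded_relational_monoid R e
  for add :: "'k \<Rightarrow> 'k \<Rightarrow> 'k" (infixl "\<oplus>" 65)
    and mult :: "'k \<Rightarrow> 'k \<Rightarrow> 'k" (infixl "\<odot>" 70)
    and zero one :: 'k and star :: "'k \<Rightarrow> 'k"
    and R :: "'x ternary" and e :: 'x
begin

abbreviation cstar :: "('x \<Rightarrow> 'k) \<Rightarrow> 'x \<Rightarrow> 'k" where
  "cstar \<equiv> conv_star add zero mult star R e"

lemma conv_zero_at_unit: "(f(e := zero) \<otimes> g) e = zero"
  unfolding conv_def by (rule sum.neutral) (auto simp: zero_left dest: unit_decomposition)

lemma cstar_unfold: "cstar f x = star (f e) \<odot> (\<delta> x \<oplus> (f(e := zero) \<otimes> cstar f) x)"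
proof (cases "x = e")
  case True
  then show ?thesis
    by (simp add: conv_star_unit[OF graded] conv_zero_at_unit delta_def)
next
  case False
  have "(f(e := zero) \<otimes> cstar f) x =
      sum.F (\<lambda>(y, z). f y \<odot> cstar f z) {(y, z). R x y z \<and> y \<noteq> e}"
    unfolding conv_def
    by (rule sum.mono_neutral_cong_right) (auto simp: zero_left)
  with False show ?thesis
    by (simp add: conv_star_nonunit[OF graded add.comm_monoid_axioms] delta_def)
qed

lemma delta_le_cstar: "conv.le \<delta> (cstar f)"
  by (simp add: fun_le_iff delta_def conv_star_unit[OF graded] one_le_star)

lemma conv_cstar_le_cstar: "conv.le (f \<otimes> cstar f) (cstar f)"
proof -
  have "f y \<odot> cstar f z \<sqsubseteq> cstar f x" if "R x y z" for x y z
  proof (cases "y = e")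
    case True
    then have "x = z"
      using that rel_unit_left_eq by auto
    moreover have "f e \<odot> cstar f x \<sqsubseteq> cstar f x"
      unfolding cstar_unfold[of f x] mult.assoc[symmetric]
      by (intro mult_right_mono mult_star_le_star)
    ultimately show ?thesis
      using True by simp
  next
    case False
    then have "f y \<odot> cstar f z \<sqsubseteq> \<delta> x \<oplus> (f(e := zero) \<otimes> cstar f) x"
      using mult_le_conv[OF that, of "f(e := zero)" "cstar f"] by (simp add: order.le_supI2)
    also have "\<dots> \<sqsubseteq> cstar f x"
      using mult_right_mono[OF one_le_star] by (simp add: cstar_unfold[of f x])
    finally show ?thesis .
  qed
  then show ?thesis
    by (simp add: conv_fun_le_iff)
qed

lemma cstar_conv_le:
  assumes "conv.le (f \<otimes> b) b"
  shows "conv.le (cstar f \<otimes> b) b"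
proof -
  have f_b: "f y \<odot> b z \<sqsubseteq> b x" if "R x y z" for x y z
    using assms that by (simp add: conv_fun_le_iff)
  have "cstar f y \<odot> b z \<sqsubseteq> b x" if "R x y z" for x y z
    using that
  proof (induction y arbitrary: x z rule: decomposition_induct)
    case (less y)
    have "(f(e := zero)) u \<odot> cstar f v \<odot> b z \<sqsubseteq> b x" if "R y u v" for u v
    proof (cases "u = e")
      case False
      obtain w where "R x u w" and "R w v z"
        using \<open>R y u v\<close> less.prems rel_assoc by blast
      have "f u \<odot> (cstar f v \<odot> b z) \<sqsubseteq> f u \<odot> b w"
        using \<open>R y u v\<close> \<open>R w v z\<close> False by (intro mult_left_mono less.IH)
      also have "\<dots> \<sqsubseteq> b x"
        using \<open>R x u w\<close> by (rule f_b)
      finally show ?thesis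
        using False by (simp add: mult.assoc)
    qed (simp add: zero_left)
    moreover have "\<delta> y \<odot> b z \<sqsubseteq> b x"
      using less.prems rel_unit_left_eq by (auto simp: delta_def zero_left)
    ultimately have "(\<delta> y \<oplus> (f(e := zero) \<otimes> cstar f) y) \<odot> b z \<sqsubseteq> b x"
      by (simp add: distrib_right conv_mult_le_iff)
    then have "cstar f y \<odot> b z \<sqsubseteq> star (f e) \<odot> b x"
      by (simp add: cstar_unfold[of f y] mult.assoc mult_left_mono)
    also have "\<dots> \<sqsubseteq> b x"
      by (intro star_mult_le f_b rel_unit_left)
    finally show ?case .
  qed
  then show ?thesis
    by (simp add: conv_fun_le_iff)
qed

lemma conv_cstar_le:
  assumes "conv.le (b \<otimes> f) b"
  shows "conv.le (b \<otimes> cstar f) b"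
proof -
  have b_f: "b y \<odot> f z \<sqsubseteq> b x" if "R x y z" for x y z
    using assms that by (simp add: conv_fun_le_iff)
  have "b y \<odot> cstar f z \<sqsubseteq> b x" if "R x y z" for x y z
    using that
  proof (induction z arbitrary: x y rule: decomposition_induct)
    case (less z)
    have "b y \<odot> ((f(e := zero)) u \<odot> cstar f v) \<sqsubseteq> b x" if "R z u v" for u v
    proof (cases "u = e")
      case False
      obtain w where "R w y u" and "R x w v"
        using \<open>R z u v\<close> less.prems rel_assoc by blast
      have "b y \<odot> f u \<odot> cstar f v \<sqsubseteq> b w \<odot> cstar f v"
        using \<open>R w y u\<close> by (intro mult_right_mono b_f)
      also have "\<dots> \<sqsubseteq> b x"
        using \<open>R z u v\<close> \<open>R x w v\<close> False by (intro less.IH)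
      finally show ?thesis
        using False by (simp add: mult.assoc)
    qed (simp add: zero_left zero_right)
    moreover have "b y \<odot> \<delta> z \<sqsubseteq> b x"
      using less.prems rel_unit_right_eq by (auto simp: delta_def zero_right)
    ultimately have b_unfold: "b y \<odot> (\<delta> z \<oplus> (f(e := zero) \<otimes> cstar f) z) \<sqsubseteq> b x"
      by (simp add: distrib_left mult_conv_le_iff)
    have "b y \<odot> star (f e) \<sqsubseteq> b y"
      by (intro mult_star_le b_f rel_unit_right)
    then have "b y \<odot> cstar f z \<sqsubseteq> b y \<odot> (\<delta> z \<oplus> (f(e := zero) \<otimes> cstar f) z)"
      unfolding cstar_unfold[of f z] mult.assoc[symmetric] by (rule mult_right_mono)
    also note b_unfold
    finally show ?case .
  qed
  then show ?thesis
    by (simp add: conv_fun_le_iff)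
qed

sublocale conv: kleene_algebra "\<lambda>f g x. f x \<oplus> g x" "conv add zero mult R" "\<lambda>x. zero" \<delta> cstar
  by (intro conv.kleene_algebraI delta_le_cstar conv_cstar_le_cstar cstar_conv_le conv_cstar_le)

end

theorem theorem7p6:
  fixes R S :: "'x ternary" and e :: 'x
    and add seq par :: "'k \<Rightarrow> 'k \<Rightarrow> 'k" and zero one :: 'k and star_seq star_par :: "'k \<Rightarrow> 'k"
  assumes "relational_interchange_monoid R S e"
    and "finitely_decomposable R" and "finitely_decomposable S"
    and "graded R e" and "graded S e"
    and "interchange_kleene_algebra add seq par zero one star_seq star_par"
  shows "interchange_kleene_algebra
    (\<lambda>f g x. add (f x) (g x))
    (conv add zero seq R)
    (conv add zero par S)
    (\<lambda>x. zero)
    (delta zero one e)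
    (conv_star add zero seq star_seq R e)
    (conv_star add zero par star_par S e)"
proof -
  interpret rel: relational_interchange_monoid R S e
    by fact
  interpret K: interchange_kleene_algebra add seq par zero one star_seq star_par
    by fact
  interpret seq: convolution_kleene_algebra add seq zero one star_seq R e
    using assms by unfold_locales
  interpret par: convolution_kleene_algebra add par zero one star_par S e
    using assms by unfold_locales
  interpret convolution_interchange add seq par zero one one R S
    by unfold_locales (fact K.interchange rel.rel_interchange)+
  show ?thesis
    by unfold_locales (simp add: seq.fun_le_iff conv_interchange)
qed

end
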